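(* Fix a mesh $\mathcal{T}_h$, $c>0$ and $\nu\ge0$. Let $\boldsymbol{u}\in\mathbb{R}^{N_{\mathbb{B}}}$ be the solution of $$\min\ \tfrac12\boldsymbol{v}^T\mathcal{A}\boldsymbol{v}-\boldsymbol{f}^T\boldsymbol{v}\quad\text{subject to }\boldsymbol{v}\in\mathbb{R}^{N_{\mathbb{B}}},\ \boldsymbol{v}\le\boldsymbol{\beta}\text{ (componentwise)}.$$ Consider the semismooth Newton method: given an initialization $(\boldsymbol{u}_0,\boldsymbol{\lambda}_0)\in\mathbb{R}^{N_{\mathbb{B}}}\times\mathbb{R}^{N_{\mathbb{B}}}$, for $k=0,1,2,\dots$ set $$\mathbb{A}_k=\{j\in\mathbb{B}:(\boldsymbol{\lambda}_k)_j+c((\boldsymbol{u}_k)_j-\beta(x_j))>0\},\qquad\mathbb{F}_k=\mathbb{B}\setminus\mathbb{A}_k,$$ let $\boldsymbol{u}_{k+1}$ be the minimizer of $\frac12\boldsymbol{v}^T\mathcal{A}\boldsymbol{v}-\boldsymbol{f}^T\boldsymbol{v}$ over all $\boldsymbol{v}\in\mathbb{R}^{N_{\mathbb{B}}}$ with $v_j=\beta(x_j)$ for $j\in\mathbb{A}_k$ (equivalently, an unconstrained minimization over the components indexed by $\mathbb{F}_k$), and let $\boldsymbol{\lambda}_{k+1}=\boldsymbol{f}-\mathcal{A}\boldsymbol{u}_{k+1}$. Then the sequence $(\boldsymbol{u}_k)$ generated by this method converges q-superlinearly to $\boldsymbol{u}$.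
   Context: $\Omega\subset\mathbb{R}^d$, $d=2$ or $d=3$, is a bounded Lipschitz domain whose boundary $\Gamma$ is polygonal or polyhedral, $\mathcal{T}_h$ is a triangulation of $\bar\Omega$ belonging to a regular family, $y_\Omega\in L^2(\Omega)$ and $\beta\in C(\Gamma)$. $Y_h=\{y_h\in C(\bar\Omega): y_h|_T\in P^1(T)\ \forall T\in\mathcal{T}_h\}$, with nodes $x_1,\dots,x_N$ and nodal basis $e_1,\dots,e_N$. $\mathbb{I}=\{j:x_j\in\Omega\}$ and $\mathbb{B}=\{j:x_j\in\Gamma\}$ are the sets of interior and boundary indexes, with cardinalities $N_{\mathbb{I}}$, $N_{\mathbb{B}}$; vectors in $\mathbb{R}^N$ are ordered with interior indexes first, and vectors in $\mathbb{R}^{N_{\mathbb{B}}}$ are indexed by $\mathbb{B}$. $\mathcal{K}_{i,j}=\int_\Omega\nabla e_i\cdot\nabla e_j\,dx$, $\mathcal{M}_{i,j}=\int_\Omega e_ie_j\,dx$, $\mathcal{B}_{i,j}=\int_\Gamma e_ie_j\,ds$ for $1\le i,j\le N$. $\mathcal{I}$ and $\mathcal{O}$ are the $N\times N$ identity and zero matrices; index sets in subscripts denote the corresponding submatrices, ":" meaning all indexes. $\mathcal{S}\in\mathbb{R}^{N\times N_{\mathbb{B}}}$ is $\mathcal{S}=\begin{pmatrix}\mathcal{K}_{\mathbb{I},\mathbb{I}}&\mathcal{K}_{\mathbb{I},\mathbb{B}}\\ \mathcal{O}_{\mathbb{B},\mathbb{I}}&\mathcal{I}_{\mathbb{B},\mathbb{B}}\end{pmatrix}^{-1}\mathcal{I}_{:,\mathbb{B}}$.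 $\mathcal{A}=\mathcal{S}^T\mathcal{M}\mathcal{S}+\nu\mathcal{B}_{\mathbb{B},\mathbb{B}}$ and $\boldsymbol{f}=\mathcal{S}^T\mathcal{M}\boldsymbol{y}_\Omega$, where $\boldsymbol{y}_\Omega\in\mathbb{R}^N$ is the vector of nodal values of the $L^2(\Omega)$-projection of $y_\Omega$ onto $Y_h$. $\boldsymbol{\beta}=(\beta(x_j))_{j\in\mathbb{B}}$. Only an upper control bound is considered.
   Formalization: As the method can cycle for some initializations, convergence is not claimed for all: it is proved q-superlinear to u for (u_0, λ_0) close enough to (u, f − Au), and for every initialization whose sequence (u_k) converges. *)

theory Defs
  imports "HOL-Analysis.Analysis" "HOL-Library.Landau_Symbols"
begin

section \<open>Domain and mesh\<close>

text \<open>
  Bounded Lipschitz domain: around each boundary point \<open>p\<close> there are a direction \<open>n\<close> and a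
  cylinder with axis \<open>n\<close>, radius \<open>r\<close> and half-height \<open>h\<close> in which \<open>\<Omega>\<close> is exactly the part
  strictly above the graph of a Lipschitz function on the hyperplane orthogonal to \<open>n\<close>.
\<close>

definition lipschitz_domain :: "'a::euclidean_space set \<Rightarrow> bool" where
  "lipschitz_domain \<Omega> \<longleftrightarrow> open \<Omega> \<and> connected \<Omega> \<and> \<Omega> \<noteq> {} \<and> bounded \<Omega> \<and>
     (\<forall>p\<in>frontier \<Omega>. \<exists>n r h L g. norm n = 1 \<and> r > 0 \<and> h > 0 \<and>
        L-lipschitz_on {w. n \<bullet> w = 0} g \<and>
        (\<forall>w. n \<bullet> w = 0 \<and> norm w < r \<longrightarrow> \<bar>g w\<bar> < h) \<and>
        (\<forall>w t. n \<bullet> w = 0 \<and> norm w < r \<and> \<bar>t\<bar> < h \<longrightarrow>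
           (p + w + t *\<^sub>R n \<in> \<Omega> \<longleftrightarrow> g w < t)))"

definition polyhedral_boundary :: "'a::euclidean_space set \<Rightarrow> bool" where
  "polyhedral_boundary \<Omega> \<longleftrightarrow>
     (\<exists>\<F>. finite \<F> \<and> (\<forall>F\<in>\<F>. polytope F \<and> aff_dim F = int DIM('a) - 1) \<and> frontier \<Omega> = \<Union>\<F>)"

definition mesh_of :: "'a::euclidean_space set \<Rightarrow> 'a set set \<Rightarrow> bool" where
  "mesh_of \<Omega> \<T> \<longleftrightarrow> triangulation \<T> \<and> (\<forall>T\<in>\<T>. int DIM('a) simplex T) \<and> \<Union>\<T> = closure \<Omega>"

text \<open>Diameter of the largest ball contained in \<open>T\<close>.\<close>

definition inball_diameter :: "'a::euclidean_space set \<Rightarrow> real" where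
  "inball_diameter T = Sup {2 * r | r. r \<ge> 0 \<and> (\<exists>z. cball z r \<subseteq> T)}"

text \<open>
  Regularity is uniform shape regularity over the whole family. No mesh sizes tending to zero are
  required of the family, so this is the weaker form of the hypothesis.
\<close>

definition regular_family :: "'a::euclidean_space set \<Rightarrow> 'a set set set \<Rightarrow> bool" where
  "regular_family \<Omega> \<TT> \<longleftrightarrow> (\<forall>\<T>\<in>\<TT>. mesh_of \<Omega> \<T>) \<and>
     (\<exists>\<sigma>. \<forall>\<T>\<in>\<TT>. \<forall>T\<in>\<T>. diameter T \<le> \<sigma> * inball_diameter T)"

definition mesh_nodes :: "'a::euclidean_space set set \<Rightarrow> 'a set" where
  "mesh_nodes \<T> = {z. \<exists>T\<in>\<T>. z extreme_point_of T}"

section \<open>The finite element space\<close>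

text \<open>
  Elements of the space are functions on \<open>\<Union>\<T>\<close>, the closure of the domain; their values elsewhere
  are left unspecified and never matter.
\<close>

definition fe_space :: "'a::euclidean_space set set \<Rightarrow> ('a \<Rightarrow> real) set" where
  "fe_space \<T> = {y. continuous_on (\<Union>\<T>) y \<and> (\<forall>T\<in>\<T>. \<exists>a b. \<forall>z\<in>T. y z = a \<bullet> z + b)}"

definition nodal_basis ::
    "'a::euclidean_space set set \<Rightarrow> ('n \<Rightarrow> 'a) \<Rightarrow> ('n \<Rightarrow> 'a \<Rightarrow> real) \<Rightarrow> bool" where
  "nodal_basis \<T> x e \<longleftrightarrow> (\<forall>j. e j \<in> fe_space \<T>) \<and> (\<forall>i j. e j (x i) = (if i = j then 1 else 0))"

definition square_integrable :: "'a::euclidean_space set \<Rightarrow> ('a \<Rightarrow> real) \<Rightarrow> bool" where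
  "square_integrable \<Omega> y \<longleftrightarrow>
     set_borel_measurable lebesgue \<Omega> y \<and> set_integrable lebesgue \<Omega> (\<lambda>z. (y z)\<^sup>2)"

definition is_L2_projection ::
    "'a::euclidean_space set \<Rightarrow> 'a set set \<Rightarrow> ('a \<Rightarrow> real) \<Rightarrow> ('a \<Rightarrow> real) \<Rightarrow> bool" where
  "is_L2_projection \<Omega> \<T> y p \<longleftrightarrow> p \<in> fe_space \<T> \<and>
     (\<forall>w\<in>fe_space \<T>. (LINT z:\<Omega>|lebesgue. (y z - p z) * w z) = 0)"

section \<open>Integrals\<close>

text \<open>
  Pointwise gradient. For a finite element function it exists in the interior of every simplex, hence
  almost everywhere, and represents the weak gradient.
\<close>

definition gradient :: "('a::euclidean_space \<Rightarrow> real) \<Rightarrow> 'a \<Rightarrow> 'a" where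
  "gradient u z = (THE D. GDERIV u z :> D)"

text \<open>
  Surface integral over a flat piece \<open>F\<close> contained in the hyperplane \<open>n \<bullet> z = c\<close> with unit normal
  \<open>n\<close>: by Fubini it is the volume integral, over the prism of height 1 erected on \<open>F\<close> in direction
  \<open>n\<close>, of the function extended constantly along \<open>n\<close>. (For an \<open>F\<close> of codimension one, \<open>(n, c)\<close> is
  unique up to sign, and both signs give the same value.)
\<close>

definition flat_surface_integral :: "'a::euclidean_space set \<Rightarrow> ('a \<Rightarrow> real) \<Rightarrow> real" where
  "flat_surface_integral F g =
     (let (n, c) = (SOME (n, c). norm n = 1 \<and> F \<subseteq> {z. n \<bullet> z = c})
      in LINT z:{p + t *\<^sub>R n | p t. p \<in> F \<and> 0 \<le> t \<and> t \<le> 1}|lebesgue. g (z - (n \<bullet> z - c) *\<^sub>R n))"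

text \<open>
  The boundary of a meshed domain is the union of the mesh facets it contains, and these overlap only
  in sets of surface measure zero.
\<close>

definition boundary_integral ::
    "'a::euclidean_space set \<Rightarrow> 'a set set \<Rightarrow> ('a \<Rightarrow> real) \<Rightarrow> real" where
  "boundary_integral \<Omega> \<T> g =
     (\<Sum>F\<in>{F. F \<subseteq> frontier \<Omega> \<and> (\<exists>T\<in>\<T>. F facet_of T)}. flat_surface_integral F g)"

section \<open>Matrices\<close>

text \<open>
  Nodes are indexed by a finite type \<open>'n\<close> (so \<open>N = CARD('n)\<close>) through \<open>x :: 'n \<Rightarrow> 'a\<close>, and
  \<open>bd :: 'b \<Rightarrow> 'n\<close> enumerates the boundary indexes. The index \<open>i\<close> is interior iff \<open>x i \<in> \<Omega>\<close>; there may
  be no interior index. No order is put on the indexes, since none of the quantities depends on it.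
\<close>

definition stiffness_matrix ::
    "'a::euclidean_space set \<Rightarrow> ('n::finite \<Rightarrow> 'a \<Rightarrow> real) \<Rightarrow> real^'n^'n" where
  "stiffness_matrix \<Omega> e = (\<chi> i j. LINT z:\<Omega>|lebesgue. gradient (e i) z \<bullet> gradient (e j) z)"

definition mass_matrix ::
    "'a::euclidean_space set \<Rightarrow> ('n::finite \<Rightarrow> 'a \<Rightarrow> real) \<Rightarrow> real^'n^'n" where
  "mass_matrix \<Omega> e = (\<chi> i j. LINT z:\<Omega>|lebesgue. e i z * e j z)"

definition boundary_mass_matrix ::
    "'a::euclidean_space set \<Rightarrow> 'a set set \<Rightarrow> ('n::finite \<Rightarrow> 'a \<Rightarrow> real) \<Rightarrow> real^'n^'n" where
  "boundary_mass_matrix \<Omega> \<T> e = (\<chi> i j. boundary_integral \<Omega> \<T> (\<lambda>z. e i z * e j z))"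

text \<open>Rows of the stiffness matrix for interior indexes, rows of the identity for boundary ones.\<close>

definition dirichlet_matrix ::
    "'a::euclidean_space set \<Rightarrow> ('n::finite \<Rightarrow> 'a) \<Rightarrow> ('n \<Rightarrow> 'a \<Rightarrow> real) \<Rightarrow> real^'n^'n" where
  "dirichlet_matrix \<Omega> x e =
     (\<chi> i j. if x i \<in> \<Omega> then stiffness_matrix \<Omega> e $ i $ j else mat 1 $ i $ j)"

definition boundary_columns :: "('b::finite \<Rightarrow> 'n::finite) \<Rightarrow> real^'n^'n \<Rightarrow> real^'b^'n" where
  "boundary_columns bd Q = (\<chi> i b. Q $ i $ bd b)"

definition boundary_block :: "('b::finite \<Rightarrow> 'n::finite) \<Rightarrow> real^'n^'n \<Rightarrow> real^'b^'b" where
  "boundary_block bd Q = (\<chi> a b. Q $ bd a $ bd b)"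

definition solution_matrix ::
    "'a::euclidean_space set \<Rightarrow> ('n::finite \<Rightarrow> 'a) \<Rightarrow> ('b::finite \<Rightarrow> 'n) \<Rightarrow> ('n \<Rightarrow> 'a \<Rightarrow> real)
      \<Rightarrow> real^'b^'n" where
  "solution_matrix \<Omega> x bd e = matrix_inv (dirichlet_matrix \<Omega> x e) ** boundary_columns bd (mat 1)"

definition reduced_matrix ::
    "'a::euclidean_space set \<Rightarrow> 'a set set \<Rightarrow> ('n::finite \<Rightarrow> 'a) \<Rightarrow> ('b::finite \<Rightarrow> 'n)
      \<Rightarrow> ('n \<Rightarrow> 'a \<Rightarrow> real) \<Rightarrow> real \<Rightarrow> real^'b^'b" where
  "reduced_matrix \<Omega> \<T> x bd e \<nu> =
     transpose (solution_matrix \<Omega> x bd e) ** mass_matrix \<Omega> e ** solution_matrix \<Omega> x bd e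
     + \<nu> *\<^sub>R boundary_block bd (boundary_mass_matrix \<Omega> \<T> e)"

definition reduced_rhs ::
    "'a::euclidean_space set \<Rightarrow> ('n::finite \<Rightarrow> 'a) \<Rightarrow> ('b::finite \<Rightarrow> 'n) \<Rightarrow> ('n \<Rightarrow> 'a \<Rightarrow> real)
      \<Rightarrow> real^'n \<Rightarrow> real^'b" where
  "reduced_rhs \<Omega> x bd e y = (transpose (solution_matrix \<Omega> x bd e) ** mass_matrix \<Omega> e) *v y"

section \<open>The semismooth Newton method\<close>

definition quadratic_objective :: "real^'b^'b \<Rightarrow> real^'b \<Rightarrow> real^'b \<Rightarrow> real" where
  "quadratic_objective A f v = 1/2 * (v \<bullet> (A *v v)) - f \<bullet> v"

definition active_set :: "real \<Rightarrow> real^'b \<Rightarrow> real^'b \<Rightarrow> real^'b \<Rightarrow> 'b set" where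
  "active_set c \<beta> u l = {j. l $ j + c * (u $ j - \<beta> $ j) > 0}"

definition semismooth_newton_sequence ::
    "real^'b^'b \<Rightarrow> real^'b \<Rightarrow> real^'b \<Rightarrow> real \<Rightarrow> (nat \<Rightarrow> real^'b) \<Rightarrow> (nat \<Rightarrow> real^'b) \<Rightarrow> bool" where
  "semismooth_newton_sequence A f \<beta> c U \<Lambda> \<longleftrightarrow>
     (\<forall>k. is_arg_min (quadratic_objective A f)
            (\<lambda>v. \<forall>j\<in>active_set c \<beta> (U k) (\<Lambda> k). v $ j = \<beta> $ j) (U (Suc k)) \<and>
          \<Lambda> (Suc k) = f - A *v U (Suc k))"

text \<open>
  The Landau form also covers iterates equal to the limit: from some index on, \<open>X k = l\<close> forces
  \<open>X (Suc k) = l\<close>.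

  Without a condition on the initialization the iteration need not converge, since it can cycle
  through finitely many active sets. Convergence is therefore claimed for initializations near the
  solution and its multiplier, and for every initialization whose iterates converge at all.
\<close>

definition q_superlinear :: "(nat \<Rightarrow> 'v::real_normed_vector) \<Rightarrow> 'v \<Rightarrow> bool" where
  "q_superlinear X l \<longleftrightarrow>
     X \<longlonglongrightarrow> l \<and> (\<lambda>k. norm (X (Suc k) - l)) \<in> o(\<lambda>k. norm (X k - l))"

end

theory Submission
  imports Defs
begin

text \<open>
  The matrix \<open>A\<close> is symmetric positive definite: mass, stiffness and boundary mass matrices are Gram
  matrices, the Dirichlet matrix is injective because a finite element function with vanishing energy
  is constant on the connected domain and vanishes at a boundary node, and so \<open>S\<close> is injective.

  For a positive definite \<open>A\<close> convergence means finite termination. Near the solution and its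
  multiplier, the active set is correct at every index where complementarity is strict, and at the
  remaining indices either choice is harmless, so a single step hits \<open>u\<close> exactly. For arbitrary
  initialization the iterates take finitely many values, one for each active set; a convergent
  sequence is therefore eventually constant, and a fixed point of the iteration satisfies the
  complementarity system, which has \<open>u\<close> as its only solution.
\<close>

section \<open>The active set iteration for a positive definite matrix\<close>

lemma inner_symmetric_matrix:
  fixes A :: "real^'n^'n"
  assumes "transpose A = A"
  shows "x \<bullet> (A *v y) = y \<bullet> (A *v x)"
  by (metis assms dot_lmul_matrix inner_commute transpose_matrix_vector)

lemma quadratic_objective_line:
  assumes "transpose A = A"
  shows "quadratic_objective A f (u + t *\<^sub>R d) =
    quadratic_objective A f u - t * ((f - A *v u) \<bullet> d) + t\<^sup>2 / 2 * (d \<bullet> (A *v d))"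
proof -
  have "A *v (u + t *\<^sub>R d) = A *v u + t *\<^sub>R (A *v d)"
    by (simp add: matrix_vector_right_distrib matrix_vector_mult_scaleR)
  moreover have "u \<bullet> (A *v d) = d \<bullet> (A *v u)"
    by (rule inner_symmetric_matrix[OF assms])
  moreover have "(A *v u) \<bullet> d = d \<bullet> (A *v u)" by (rule inner_commute)
  ultimately show ?thesis
    by (simp add: quadratic_objective_def inner_add_left inner_add_right inner_diff_left
        power2_eq_square distrib_left distrib_right right_diff_distrib)
qed

text \<open>A positive slope along \<open>d\<close> would beat the quadratic term for small
  \<open>t\<close> and contradict minimality. Feasibility is asked only on a segment starting at
  \<open>u\<close>, which suits one-sided bounds as well as equality constraints.\<close>

lemma quadratic_arg_min_variational:
  assumes "transpose A = A" and min: "is_arg_min (quadratic_objective A f) P u"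
    and feasible: "\<And>t. 0 < t \<Longrightarrow> t \<le> 1 \<Longrightarrow> P (u + t *\<^sub>R d)"
  shows "(f - A *v u) \<bullet> d \<le> 0"
proof (rule ccontr)
  define s q where "s = (f - A *v u) \<bullet> d" and "q = d \<bullet> (A *v d)"
  assume "\<not> (f - A *v u) \<bullet> d \<le> 0"
  then have "s > 0" by (simp add: s_def)
  \<comment> \<open>This choice gives \<open>t * q \<le> s\<close>, so the quadratic term undoes at
    most half of the linear decrease \<open>t * s\<close>.\<close>
  define t where "t = min 1 (s / (\<bar>q\<bar> + 1))"
  have t: "0 < t" "t \<le> 1" using \<open>s > 0\<close> by (auto simp: t_def)
  have "t * q \<le> t * (\<bar>q\<bar> + 1)" using t by (intro mult_left_mono) auto
  also have "\<dots> \<le> s / (\<bar>q\<bar> + 1) * (\<bar>q\<bar> + 1)" by (intro mult_right_mono) (auto simp: t_def)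
  also have "\<dots> = s" by (simp add: add_nonneg_eq_0_iff)
  finally have "0 < t * (s - t * q / 2)" using t \<open>s > 0\<close> by simp
  then have "quadratic_objective A f (u + t *\<^sub>R d) < quadratic_objective A f u"
    unfolding quadratic_objective_line[OF assms(1)] s_def q_def
    by (simp add: power2_eq_square algebra_simps)
  with min feasible[OF t] show False by (auto simp: is_arg_min_def)
qed

section \<open>Eventually constant sequences\<close>

lemma q_superlinear_eventually_eq:
  assumes "\<forall>\<^sub>F k in sequentially. X k = l"
  shows "q_superlinear X l"
  unfolding q_superlinear_def
proof
  show "X \<longlonglongrightarrow> l" using assms by (rule tendsto_eventually)
  have "\<forall>\<^sub>F k in sequentially. norm (X (Suc k) - l) = 0"
    using assms by (subst (asm) eventually_sequentially_Suc[symmetric]) (auto elim: eventually_mono)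
  \<comment> \<open>The left side is eventually zero, so the bound holds with every constant, even
    where the right side vanishes.\<close>
  then show "(\<lambda>k. norm (X (Suc k) - l)) \<in> o(\<lambda>k. norm (X k - l))"
    by (intro landau_o.smallI) (auto elim: eventually_mono)
qed

text \<open>Removing \<open>l\<close> from the finite range leaves a closed set, so its complement
  is a neighbourhood of \<open>l\<close>.\<close>

lemma tendsto_finite_range_eventually_eq:
  fixes X :: "nat \<Rightarrow> 'v::t1_space"
  assumes "X \<longlonglongrightarrow> l" "finite (range X)"
  shows "\<forall>\<^sub>F k in sequentially. X k = l"
proof -
  have "open (- (range X - {l}))"
    using assms(2) by (intro open_Compl finite_imp_closed) auto
  with assms(1) have "\<forall>\<^sub>F k in sequentially. X k \<in> - (range X - {l})"
    by (rule topological_tendstoD) simp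
  then show ?thesis by (auto elim: eventually_mono)
qed

section \<open>Strict monotonicity, complementarity and single Newton steps\<close>

locale spd_quadratic =
  fixes A :: "real^'b^'b" and f \<beta> :: "real^'b" and c :: real
  assumes sym: "transpose A = A"
    and pos: "v \<noteq> 0 \<Longrightarrow> v \<bullet> (A *v v) > 0"
    and c_pos: "c > 0"
begin

text \<open>The negative gradient of the objective; at a constrained minimizer it is the Lagrange
  multiplier.\<close>

abbreviation multiplier :: "real^'b \<Rightarrow> real^'b" where
  "multiplier v \<equiv> f - A *v v"

text \<open>Positive definiteness makes \<open>multiplier\<close> strictly antitone, so the products
  cannot sum to a nonnegative number unless \<open>v = w\<close>. All identifications of iterates
  below use this criterion.\<close>

lemma monotone_eqI:
  assumes "\<And>j. 0 \<le> (v $ j - w $ j) * (multiplier v $ j - multiplier w $ j)"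
  shows "v = w"
proof (rule ccontr)
  assume "v \<noteq> w"
  have "0 \<le> (v - w) \<bullet> (multiplier v - multiplier w)"
    unfolding inner_vec_def using assms by (intro sum_nonneg) simp
  also have "\<dots> = - ((v - w) \<bullet> (A *v (v - w)))"
    by (simp add: matrix_vector_mult_diff_distrib inner_diff_right)
  finally show False using pos[of "v - w"] \<open>v \<noteq> w\<close> by simp
qed

lemma obstacle_complementarity:
  assumes "is_arg_min (quadratic_objective A f) (\<lambda>v. \<forall>j. v $ j \<le> \<beta> $ j) u"
  shows "u $ j \<le> \<beta> $ j" "0 \<le> multiplier u $ j" "multiplier u $ j * (\<beta> $ j - u $ j) = 0"
proof -
  have u: "u $ i \<le> \<beta> $ i" for i using assms by (simp add: is_arg_min_def)
  show "u $ j \<le> \<beta> $ j" by (rule u)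
  \<comment> \<open>Lowering a component never violates an upper bound.\<close>
  have "multiplier u \<bullet> (- axis j 1) \<le> 0"
  proof (rule quadratic_arg_min_variational[OF sym assms], intro allI)
    fix t i assume "0 < (t::real)"
    show "(u + t *\<^sub>R - axis j 1) $ i \<le> \<beta> $ i"
      using u[of i] \<open>0 < t\<close> by (auto simp: axis_def)
  qed
  then show nonneg: "0 \<le> multiplier u $ j" by (simp add: inner_axis)
  \<comment> \<open>This direction raises component \<open>j\<close> to its bound, reached exactly
    at \<open>t = 1\<close>.\<close>
  have "multiplier u \<bullet> axis j (\<beta> $ j - u $ j) \<le> 0"
  proof (rule quadratic_arg_min_variational[OF sym assms], intro allI)
    fix t i assume t: "0 < (t::real)" "t \<le> 1"
    have "t * (\<beta> $ j - u $ j) \<le> 1 * (\<beta> $ j - u $ j)" using u[of j] t by (intro mult_right_mono) auto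
    then show "(u + t *\<^sub>R axis j (\<beta> $ j - u $ j)) $ i \<le> \<beta> $ i"
      using u[of i] by (auto simp: axis_def)
  qed
  moreover have "0 \<le> multiplier u $ j * (\<beta> $ j - u $ j)" using nonneg u[of j] by simp
  ultimately show "multiplier u $ j * (\<beta> $ j - u $ j) = 0" by (simp add: inner_axis)
qed

lemma newton_step:
  assumes "semismooth_newton_sequence A f \<beta> c U \<Lambda>"
  shows "j \<in> active_set c \<beta> (U k) (\<Lambda> k) \<Longrightarrow> U (Suc k) $ j = \<beta> $ j"
    and "j \<notin> active_set c \<beta> (U k) (\<Lambda> k) \<Longrightarrow> multiplier (U (Suc k)) $ j = 0"
    and "\<Lambda> (Suc k) = multiplier (U (Suc k))"
proof -
  let ?K = "active_set c \<beta> (U k) (\<Lambda> k)"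
  have min: "is_arg_min (quadratic_objective A f) (\<lambda>v. \<forall>j\<in>?K. v $ j = \<beta> $ j) (U (Suc k))"
    and "\<Lambda> (Suc k) = multiplier (U (Suc k))"
    using assms by (auto simp: semismooth_newton_sequence_def)
  then show "\<Lambda> (Suc k) = multiplier (U (Suc k))" by simp
  show "U (Suc k) $ j = \<beta> $ j" if "j \<in> ?K" using min that by (simp add: is_arg_min_def)
  assume j: "j \<notin> ?K"
  \<comment> \<open>An inactive component is free, so both signs of \<open>s\<close> are admissible
    and the two inequalities force equality.\<close>
  have "multiplier (U (Suc k)) \<bullet> axis j s \<le> 0" for s
    by (rule quadratic_arg_min_variational[OF sym min]) (use min j in \<open>auto simp: is_arg_min_def axis_def\<close>)
  from this[of 1] this[of "-1"] show "multiplier (U (Suc k)) $ j = 0" by (simp add: inner_axis)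
qed

text \<open>A step depends on the previous pair only through its active set: for equal sets, the
  iterates agree on the set and both multipliers vanish off it. There are finitely many sets of
  indexes.\<close>

lemma finite_range_newton_iterates:
  assumes "semismooth_newton_sequence A f \<beta> c U \<Lambda>"
  shows "finite (range (\<lambda>k. U (Suc k)))"
proof -
  define K where "K k = active_set c \<beta> (U k) (\<Lambda> k)" for k
  have eq: "U (Suc k) = U (Suc m)" if "K k = K m" for k m
  proof (rule monotone_eqI)
    fix j
    show "0 \<le> (U (Suc k) $ j - U (Suc m) $ j) *
      (multiplier (U (Suc k)) $ j - multiplier (U (Suc m)) $ j)"
      using newton_step(1,2)[OF assms, of j k] newton_step(1,2)[OF assms, of j m] that
      by (cases "j \<in> K k") (auto simp: K_def)
  qed
  \<comment> \<open>A representative step for each active set turns the iterate into a function of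
    that set.\<close>
  have "U (Suc k) = U (Suc (SOME m. K m = K k))" for k
    by (rule eq[symmetric], rule someI) simp
  then have "range (\<lambda>k. U (Suc k)) \<subseteq> (\<lambda>S. U (Suc (SOME m. K m = S))) ` UNIV" by blast
  then show ?thesis by (rule finite_subset) simp
qed

context
  fixes u :: "real^'b"
  assumes min: "is_arg_min (quadratic_objective A f) (\<lambda>v. \<forall>j. v $ j \<le> \<beta> $ j) u"
begin

text \<open>Where the sign expression is zero, complementarity makes both the multiplier and the gap
  to the bound zero, so either choice is right. Hence \<open>u\<close> itself meets the equations of
  the step: it is at the bound on the active set and has zero multiplier off it.\<close>

lemma newton_step_exact:
  assumes "semismooth_newton_sequence A f \<beta> c U \<Lambda>"
    and active: "\<And>j. multiplier u $ j + c * (u $ j - \<beta> $ j) > 0 \<Longrightarrow> j \<in> active_set c \<beta> (U k) (\<Lambda> k)"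
    and inactive: "\<And>j. multiplier u $ j + c * (u $ j - \<beta> $ j) < 0 \<Longrightarrow> j \<notin> active_set c \<beta> (U k) (\<Lambda> k)"
  shows "U (Suc k) = u"
proof (rule monotone_eqI)
  fix j
  have "multiplier u $ j = 0 \<or> u $ j = \<beta> $ j"
    using obstacle_complementarity(3)[OF min, of j] by auto
  moreover have "u $ j = \<beta> $ j" if "j \<in> active_set c \<beta> (U k) (\<Lambda> k)"
    using inactive[of j] that obstacle_complementarity[OF min, of j] c_pos
    by (smt (verit) mult_eq_0_iff mult_less_0_iff)
  moreover have "multiplier u $ j = 0" if "j \<notin> active_set c \<beta> (U k) (\<Lambda> k)"
    using active[of j] that obstacle_complementarity[OF min, of j]
    by (smt (verit) mult_eq_0_iff)
  ultimately show "0 \<le> (U (Suc k) $ j - u $ j) * (multiplier (U (Suc k)) $ j - multiplier u $ j)"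
    using newton_step(1,2)[OF assms(1), of j k] by (cases "j \<in> active_set c \<beta> (U k) (\<Lambda> k)") auto
qed

text \<open>At a fixed point the step equations hold for the pair that defined the active set. On
  this set the gap is zero, so activity means a positive multiplier; off it the multiplier is zero,
  so inactivity means feasibility. This is complementarity, which monotonicity makes uniquely
  solvable.\<close>

lemma newton_fixed_point:
  assumes "semismooth_newton_sequence A f \<beta> c U \<Lambda>" "U (Suc k) = U k" "\<Lambda> k = multiplier (U k)"
  shows "U k = u"
proof (rule monotone_eqI)
  fix j
  note comp = obstacle_complementarity[OF min, of j]
  consider "U k $ j = \<beta> $ j" "multiplier (U k) $ j > 0"
    | "multiplier (U k) $ j = 0" "U k $ j \<le> \<beta> $ j"
    using newton_step(1,2)[OF assms(1), of j k] assms(2,3) c_pos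
    by (cases "j \<in> active_set c \<beta> (U k) (\<Lambda> k)")
      (auto simp: active_set_def not_less mult_le_0_iff)
  then show "0 \<le> (U k $ j - u $ j) * (multiplier (U k) $ j - multiplier u $ j)"
  proof cases
    case 1
    have "0 \<le> (\<beta> $ j - u $ j) * multiplier (U k) $ j" using comp(1) 1(2) by simp
    then show ?thesis using 1 comp(3) by (simp add: algebra_simps)
  next
    case 2
    have "0 \<le> (\<beta> $ j - U k $ j) * multiplier u $ j" using comp(2) 2(2) by simp
    then show ?thesis using 2 comp(3) by (simp add: algebra_simps)
  qed
qed

lemma newton_locally_superlinear:
  "\<exists>\<delta>>0. \<forall>U \<Lambda>. semismooth_newton_sequence A f \<beta> c U \<Lambda> \<and>
     dist (U 0) u < \<delta> \<and> dist (\<Lambda> 0) (multiplier u) < \<delta> \<longrightarrow> q_superlinear U u"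
proof -
  define g where "g j = multiplier u $ j + c * (u $ j - \<beta> $ j)" for j
  \<comment> \<open>Changes below \<open>\<delta>\<close> in both arguments move each
    \<open>g j\<close> by less than \<open>\<delta> * (1 + c)\<close>, hence by less than the
    smallest nonzero \<open>\<bar>g j\<bar>\<close>. The inserted 1 keeps the minimum defined when
    every \<open>g j\<close> is zero.\<close>
  define \<delta> where "\<delta> = Min (insert 1 ((\<lambda>j. \<bar>g j\<bar>) ` {j. g j \<noteq> 0})) / (1 + c)"
  have \<delta>: "0 < \<delta>"
    using c_pos unfolding \<delta>_def by (intro divide_pos_pos) (auto simp: Min_gr_iff)
  have \<delta>_le: "\<delta> * (1 + c) \<le> \<bar>g j\<bar>" if "g j \<noteq> 0" for j
    using that c_pos by (auto simp: \<delta>_def intro!: Min_le)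
  have "q_superlinear U u"
    if N: "semismooth_newton_sequence A f \<beta> c U \<Lambda>"
      and close: "dist (U 0) u < \<delta>" "dist (\<Lambda> 0) (multiplier u) < \<delta>" for U \<Lambda>
  proof -
    have pert: "\<bar>\<Lambda> 0 $ j + c * (U 0 $ j - \<beta> $ j) - g j\<bar> < \<delta> * (1 + c)" for j
    proof -
      have "\<bar>\<Lambda> 0 $ j - multiplier u $ j\<bar> < \<delta>"
        using component_le_norm_cart[of "\<Lambda> 0 - multiplier u" j] close(2) by (simp add: dist_norm)
      moreover have "\<bar>U 0 $ j - u $ j\<bar> \<le> \<delta>"
        using component_le_norm_cart[of "U 0 - u" j] close(1) by (simp add: dist_norm)
      then have "\<bar>c * (U 0 $ j - u $ j)\<bar> \<le> c * \<delta>" using c_pos by (simp add: abs_mult)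
      moreover have "\<Lambda> 0 $ j + c * (U 0 $ j - \<beta> $ j) - g j =
          (\<Lambda> 0 $ j - multiplier u $ j) + c * (U 0 $ j - u $ j)"
        by (simp add: g_def algebra_simps)
      moreover have "\<delta> * (1 + c) = \<delta> + c * \<delta>" by (simp add: algebra_simps)
      ultimately show ?thesis by linarith
    qed
    \<comment> \<open>Closeness is used for the first step only; afterwards the pair is exactly
      \<open>u\<close> and its multiplier, so the sign conditions hold trivially.\<close>
    have "U (Suc k) = u" for k
    proof (induction k)
      case 0
      have "g j > 0 \<Longrightarrow> j \<in> active_set c \<beta> (U 0) (\<Lambda> 0)"
        "g j < 0 \<Longrightarrow> j \<notin> active_set c \<beta> (U 0) (\<Lambda> 0)" for j
        using pert[of j] \<delta>_le[of j] unfolding active_set_def mem_Collect_eq by linarith+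
      then show ?case by (intro newton_step_exact[OF N]) (auto simp: g_def)
    next
      case (Suc k)
      then show ?case
        by (intro newton_step_exact[OF N]) (auto simp: active_set_def newton_step(3)[OF N])
    qed
    then have "\<forall>\<^sub>F k in sequentially. U k = u"
      by (subst eventually_sequentially_Suc[symmetric]) simp
    then show ?thesis by (rule q_superlinear_eventually_eq)
  qed
  with \<delta> show ?thesis by blast
qed

lemma newton_convergent_superlinear:
  assumes N: "semismooth_newton_sequence A f \<beta> c U \<Lambda>" and "convergent U"
  shows "q_superlinear U u"
proof -
  obtain l where "U \<longlonglongrightarrow> l" using assms(2) by (auto simp: convergent_def)
  then have "\<forall>\<^sub>F k in sequentially. U (Suc k) = l"
    by (intro tendsto_finite_range_eventually_eq finite_range_newton_iterates[OF N]) (rule LIMSEQ_Suc)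
  then have ev: "\<forall>\<^sub>F k in sequentially. U k = l"
    by (rule eventually_sequentially_Suc[THEN iffD1])
  then obtain k where k: "\<And>m. m \<ge> k \<Longrightarrow> U m = l" by (auto simp: eventually_sequentially)
  \<comment> \<open>The index is \<open>Suc k\<close> because \<open>\<Lambda> 0\<close> is
    arbitrary: only after a step is the second iterate the multiplier of the first.\<close>
  then have "U (Suc k) = u"
    by (intro newton_fixed_point[OF N]) (auto simp: newton_step(3)[OF N])
  with ev k show ?thesis by (intro q_superlinear_eventually_eq) auto
qed

end

end

section \<open>Positive definiteness of the reduced matrix\<close>

lemma inner_matrix_vector_sum:
  fixes Q :: "real^'n^'m"
  shows "x \<bullet> (Q *v y) = (\<Sum>i\<in>UNIV. \<Sum>j\<in>UNIV. x $ i * y $ j * Q $ i $ j)"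
  by (simp add: inner_vec_def matrix_vector_mult_def sum_distrib_left algebra_simps)

text \<open>The squared norm is expanded and integrated termwise. Values in any inner product space
  are allowed, so that basis functions, their gradients and their extensions from facets are all
  covered.\<close>

lemma set_integral_Gram_form:
  fixes g :: "'n::finite \<Rightarrow> 'a \<Rightarrow> 'c::real_inner"
  assumes "\<And>i j. set_integrable M S (\<lambda>z. g i z \<bullet> g j z)"
  shows "set_integrable M S (\<lambda>z. (norm (\<Sum>i\<in>UNIV. v $ i *\<^sub>R g i z))\<^sup>2)"
    and "(\<Sum>i\<in>UNIV. \<Sum>j\<in>UNIV. v $ i * v $ j * (LINT z:S|M. g i z \<bullet> g j z)) =
      (LINT z:S|M. (norm (\<Sum>i\<in>UNIV. v $ i *\<^sub>R g i z))\<^sup>2)"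
proof -
  have norm_eq: "(norm (\<Sum>i\<in>UNIV. v $ i *\<^sub>R g i z))\<^sup>2 =
      (\<Sum>i\<in>UNIV. \<Sum>j\<in>UNIV. v $ i * v $ j * (g i z \<bullet> g j z))" for z
    unfolding power2_norm_eq_inner
    by (subst inner_sum_left) (simp add: inner_sum_right sum_distrib_left ac_simps)
  have eq: "indicator S z *\<^sub>R (norm (\<Sum>i\<in>UNIV. v $ i *\<^sub>R g i z))\<^sup>2 =
      (\<Sum>i\<in>UNIV. \<Sum>j\<in>UNIV. v $ i * v $ j * (indicator S z *\<^sub>R (g i z \<bullet> g j z)))" for z
    unfolding norm_eq by (simp add: sum_distrib_left ac_simps)
  have int: "integrable M (\<lambda>z. indicator S z *\<^sub>R (g i z \<bullet> g j z))" for i j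
    using assms by (simp add: set_integrable_def)
  show "set_integrable M S (\<lambda>z. (norm (\<Sum>i\<in>UNIV. v $ i *\<^sub>R g i z))\<^sup>2)"
    unfolding set_integrable_def eq
    by (intro Bochner_Integration.integrable_sum integrable_mult_right int)
  show "(\<Sum>i\<in>UNIV. \<Sum>j\<in>UNIV. v $ i * v $ j * (LINT z:S|M. g i z \<bullet> g j z)) =
      (LINT z:S|M. (norm (\<Sum>i\<in>UNIV. v $ i *\<^sub>R g i z))\<^sup>2)"
    unfolding set_lebesgue_integral_def eq
    by (simp only: Bochner_Integration.integral_sum Bochner_Integration.integrable_sum
        integrable_mult_right int Bochner_Integration.integral_mult_right)
qed

text \<open>A nonnegative integrand with zero integral vanishes almost everywhere, and a nonempty
  open set is not negligible.\<close>

lemma set_integral_norm_eq_0_open: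
  assumes int: "set_integrable lebesgue S (\<lambda>z. (norm (h z))\<^sup>2)"
    and zero: "(LINT z:S|lebesgue. (norm (h z))\<^sup>2) = 0"
    and "open W" "W \<subseteq> S" "W \<noteq> {}"
  shows "\<exists>z\<in>W. h z = 0"
proof (rule ccontr)
  assume nz: "\<not> (\<exists>z\<in>W. h z = 0)"
  have "AE z in lebesgue. indicator S z *\<^sub>R (norm (h z))\<^sup>2 = 0"
    using int zero unfolding set_integrable_def set_lebesgue_integral_def
    by (subst integral_nonneg_eq_0_iff_AE[symmetric]) auto
  then have "AE z in lebesgue. z \<notin> W"
    using nz \<open>W \<subseteq> S\<close> by (auto elim!: eventually_mono simp: indicator_def split: if_splits)
  then have "negligible W"
    using \<open>open W\<close> by (auto simp: negligible_iff_null_sets AE_iff_null_sets)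
  with open_not_negligible[OF \<open>open W\<close> \<open>W \<noteq> {}\<close>] show False by simp
qed

lemma set_integrable_lebesgue_compact:
  fixes g :: "'a::euclidean_space \<Rightarrow> real"
  assumes "compact S" "continuous_on S g" "W \<in> sets lebesgue" "W \<subseteq> S"
  shows "set_integrable lebesgue W g"
proof (rule set_integrable_subset[OF _ assms(3,4)])
  have "integrable lborel (\<lambda>z. indicator S z *\<^sub>R g z)"
    using assms by (intro borel_integrable_compact)
  then show "set_integrable lebesgue S g"
    unfolding set_integrable_def
    by (subst integrable_completion) (auto dest: borel_measurable_integrable)
qed

lemma matrix_mult_matrix_inv_of_inj:
  fixes D :: "real^'n^'n"
  assumes "inj ((*v) D)"
  shows "D ** matrix_inv D = mat 1"
proof -
  have "\<exists>E. D ** E = mat 1 \<and> E ** D = mat 1"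
    using assms matrix_left_invertible_injective[of D] matrix_left_right_inverse by blast
  then show ?thesis unfolding matrix_inv_def by (rule someI2_ex) simp
qed

lemma gradient_eq:
  assumes "open W" "z \<in> W" "\<And>z'. z' \<in> W \<Longrightarrow> w z' = a \<bullet> z' + b"
  shows "gradient w z = a"
proof -
  have "((\<lambda>z. a \<bullet> z + b) has_derivative (\<lambda>h. a \<bullet> h)) (at z)"
    by (auto intro!: derivative_eq_intros)
  then have d: "(w has_derivative (\<lambda>h. a \<bullet> h)) (at z)"
    by (rule has_derivative_transform_within_open[OF _ assms(1,2)]) (simp add: assms(3))
  show ?thesis unfolding gradient_def
  proof (rule the_equality)
    show "GDERIV w z :> a" using d by (simp add: gderiv_def inner_commute)
    fix D assume "GDERIV w z :> D"
    then have "(\<lambda>h. h \<bullet> D) = (\<lambda>h. a \<bullet> h)"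
      unfolding gderiv_def using d by (rule has_derivative_unique)
    then show "D = a" by (metis inner_commute vector_eq_rdot)
  qed
qed

text \<open>The surface integral is a volume integral over a prism, so the sum is the Gram form of
  the extended functions.\<close>

lemma flat_surface_integral_Gram_nonneg:
  fixes F :: "'a::euclidean_space set" and g :: "'n::finite \<Rightarrow> 'a \<Rightarrow> real"
  assumes "compact F" and F: "aff_dim F < DIM('a)" and cont: "\<And>i. continuous_on F (g i)"
  shows "0 \<le> (\<Sum>i\<in>UNIV. \<Sum>j\<in>UNIV. v $ i * v $ j * flat_surface_integral F (\<lambda>z. g i z * g j z))"
proof -
  obtain a b where "a \<noteq> 0" "F \<subseteq> {z. a \<bullet> z = b}" using aff_lowdim_subset_hyperplane[OF F] by blast
  then have "case (a /\<^sub>R norm a, b / norm a) of (n, c) \<Rightarrow> norm n = 1 \<and> F \<subseteq> {z. n \<bullet> z = c}"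
    by (auto simp: field_simps)
  then have ex: "\<exists>q. case q of (n, c) \<Rightarrow> norm n = 1 \<and> F \<subseteq> {z. n \<bullet> z = c}" by blast
  \<comment> \<open>The normal is a choice by \<open>SOME\<close>; only its defining property is
    used, guaranteed by a hyperplane containing \<open>F\<close>.\<close>
  obtain n c where nc: "(SOME (n, c). norm n = 1 \<and> F \<subseteq> {z. n \<bullet> z = c}) = (n, c)" by fastforce
  with someI_ex[OF ex] have n: "norm n = 1" and Fn: "F \<subseteq> {z. n \<bullet> z = c}" by auto
  define P where "P = {p + t *\<^sub>R n | p t. p \<in> F \<and> 0 \<le> t \<and> t \<le> 1}"
  \<comment> \<open>Orthogonal projection onto the hyperplane; it undoes the shift along
    \<open>n\<close> and so maps the prism back into \<open>F\<close>.\<close>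
  define \<pi> where "\<pi> z = z - (n \<bullet> z - c) *\<^sub>R n" for z
  have fsi: "flat_surface_integral F h = (LINT z:P|lebesgue. h (\<pi> z))" for h
    by (simp add: flat_surface_integral_def nc P_def \<pi>_def)
  have "P = (\<lambda>(p, t). p + t *\<^sub>R n) ` (F \<times> {0..1})" by (auto simp: P_def) blast
  then have P: "compact P"
    using \<open>compact F\<close>
    by (auto intro!: compact_continuous_image compact_Times continuous_intros simp: case_prod_beta)
  have "n \<bullet> n = 1" using n by (simp add: norm_eq_1)
  then have "\<pi> ` P \<subseteq> F" using Fn by (auto simp: P_def \<pi>_def inner_add_right)
  moreover have "continuous_on P \<pi>" unfolding \<pi>_def by (intro continuous_intros)
  ultimately have "continuous_on P (\<lambda>z. g i (\<pi> z))" for i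
    using continuous_on_compose2[OF cont] by blast
  then have "set_integrable lebesgue P (\<lambda>z. g i (\<pi> z) \<bullet> g j (\<pi> z))" for i j
    by (intro set_integrable_lebesgue_compact[OF P] continuous_intros
        fmeasurableD[OF lmeasurable_compact[OF P]]) auto
  from set_integral_Gram_form(2)[where g = "\<lambda>i z. g i (\<pi> z)", OF this, of v]
  show ?thesis by (simp add: fsi set_lebesgue_integral_def)
qed

text \<open>One value per piece leaves finitely many values, and a continuous function with finite
  range is constant on a connected set.\<close>

lemma connected_finite_pieces_constant:
  fixes w :: "'a::topological_space \<Rightarrow> real"
  assumes "connected (\<Union>\<T>)" "finite \<T>" "continuous_on (\<Union>\<T>) w" "\<And>T. T \<in> \<T> \<Longrightarrow> w constant_on T"
    and "y \<in> \<Union>\<T>" "z \<in> \<Union>\<T>"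
  shows "w y = w z"
proof -
  have "finite (w ` T)" if "T \<in> \<T>" for T
    using assms(4)[OF that] by (auto simp: constant_on_def intro: finite_subset[of _ "{_}"])
  then have "finite (w ` \<Union>\<T>)" using assms(2) by (simp add: image_Union)
  then have "w constant_on \<Union>\<T>" using assms by (intro continuous_finite_range_constant)
  then show ?thesis using assms(5,6) by (auto simp: constant_on_def)
qed

section \<open>Finite element functions and the assembled matrices\<close>

locale fe_discretization =
  fixes \<Omega> :: "'a::euclidean_space set" and \<T> :: "'a set set"
    and x :: "'n::finite \<Rightarrow> 'a" and e :: "'n \<Rightarrow> 'a \<Rightarrow> real"
  assumes open_domain: "open \<Omega>" and connected_domain: "connected \<Omega>"
    and bounded_domain: "bounded \<Omega>"
    and mesh: "mesh_of \<Omega> \<T>"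
    and nodes: "range x \<subseteq> mesh_nodes \<T>"
    and basis: "nodal_basis \<T> x e"
begin

lemma Union_mesh: "\<Union>\<T> = closure \<Omega>"
  and finite_mesh: "finite \<T>"
  and simplex_mesh: "T \<in> \<T> \<Longrightarrow> int DIM('a) simplex T"
  using mesh by (auto simp: mesh_of_def triangulation_def)

lemma compact_closure_domain: "compact (closure \<Omega>)"
  using bounded_domain by simp

lemma domain_lebesgue: "\<Omega> \<in> sets lebesgue"
  using open_domain by simp

lemma basis_continuous: "continuous_on (closure \<Omega>) (e j)"
  using basis by (auto simp: nodal_basis_def fe_space_def Union_mesh)

lemma basis_affine: "T \<in> \<T> \<Longrightarrow> \<exists>a b. \<forall>z\<in>T. e j z = a \<bullet> z + b"
  using basis by (auto simp: nodal_basis_def fe_space_def)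

lemma node_in_closure: "x i \<in> closure \<Omega>"
  using nodes by (force simp: mesh_nodes_def extreme_point_of_def simp flip: Union_mesh)

definition fe_function :: "real^'n \<Rightarrow> 'a \<Rightarrow> real" where
  "fe_function v z = (\<Sum>i\<in>UNIV. v $ i *\<^sub>R e i z)"

lemma fe_function_node: "fe_function v (x i) = v $ i"
  using basis 
    by (simp add: fe_function_def nodal_basis_def if_distrib[of "\<lambda>q. _ * q"] cong: if_cong)

lemma fe_function_continuous: "continuous_on (closure \<Omega>) (fe_function v)"
  unfolding fe_function_def by (intro continuous_intros basis_continuous)

text \<open>The form is the squared L2 norm of the finite element function. If it is zero, the
  function vanishes on \<Omega>, then on the closure by continuity, in particular at the nodes,
  where its values are the components of \<open>v\<close>.\<close>

lemma mass_matrix_pos: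
  assumes "v \<noteq> 0"
  shows "v \<bullet> (mass_matrix \<Omega> e *v v) > 0"
proof -
  have "set_integrable lebesgue \<Omega> (\<lambda>z. e i z \<bullet> e j z)" for i j
    by (intro set_integrable_lebesgue_compact[OF compact_closure_domain] continuous_intros
        basis_continuous domain_lebesgue closure_subset)
  note Gram = set_integral_Gram_form[where g = e, OF this, of v, folded fe_function_def]
  have eq: "v \<bullet> (mass_matrix \<Omega> e *v v) = (LINT z:\<Omega>|lebesgue. (norm (fe_function v z))\<^sup>2)"
    using Gram(2) by (simp add: inner_matrix_vector_sum mass_matrix_def)
  have "(LINT z:\<Omega>|lebesgue. (norm (fe_function v z))\<^sup>2) \<noteq> 0"
  proof
    assume zero: "(LINT z:\<Omega>|lebesgue. (norm (fe_function v z))\<^sup>2) = 0"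
    have "fe_function v z = 0" if "z \<in> \<Omega>" for z
    proof (rule ccontr)
      assume nz: "fe_function v z \<noteq> 0"
      have "continuous_on \<Omega> (fe_function v)"
        using fe_function_continuous closure_subset by (rule continuous_on_subset)
      then have "open (\<Omega> \<inter> fe_function v -` (- {0}))"
        using open_domain by (intro continuous_open_preimage) auto
      from set_integral_norm_eq_0_open[OF Gram(1) zero this] nz that show False by auto
    qed
    then have "fe_function v z = 0" if "z \<in> closure \<Omega>" for z
      using continuous_constant_on_closure[OF fe_function_continuous _ that, of v 0] by simp
    with node_in_closure fe_function_node[of v] have "v = 0" by (simp add: vec_eq_iff)
    with assms show False by simp
  qed
  moreover have "0 \<le> (LINT z:\<Omega>|lebesgue. (norm (fe_function v z))\<^sup>2)"
    by (simp add: set_lebesgue_integral_def)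
  ultimately show ?thesis using eq by simp
qed

text \<open>A full-dimensional simplex has nonempty interior, and an open set inside the closure of
  \<Omega> meets \<Omega> itself.\<close>

lemma interior_mesh_nonempty:
  assumes "T \<in> \<T>"
  shows "interior T \<inter> \<Omega> \<noteq> {}"
proof -
  have T: "convex T" "aff_dim T = DIM('a)"
    using simplex_mesh[OF assms] by (auto simp: convex_simplex aff_dim_simplex)
  then have "T \<noteq> {}" by auto
  then have "interior T \<noteq> {}"
    using T rel_interior_eq_empty[OF T(1)] by (simp add: aff_dim_eq_full rel_interior_interior)
  moreover have "interior T \<subseteq> closure \<Omega>" using assms interior_subset Union_mesh by blast
  ultimately show ?thesis using open_Int_closure_eq_empty[of "interior T" \<Omega>] by auto
qed

lemma gradient_basis_constant:
  assumes "T \<in> \<T>"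
  shows "\<exists>a b. (\<forall>z\<in>T. e j z = a \<bullet> z + b) \<and> (\<forall>z\<in>interior T. gradient (e j) z = a)"
proof -
  obtain a b where ab: "\<forall>z\<in>T. e j z = a \<bullet> z + b" using basis_affine[OF assms] by blast
  then have "gradient (e j) z = a" if "z \<in> interior T" for z
    using interior_subset by (intro gradient_eq[OF open_interior that]) blast
  with ab show ?thesis by blast
qed

text \<open>The integrand is constant on the interior of each simplex, and these interiors cover
  \<Omega> up to the negligible frontiers, where gradients may fail to exist.\<close>

lemma set_integrable_gradients:
  "set_integrable lebesgue \<Omega> (\<lambda>z. gradient (e i) z \<bullet> gradient (e j) z)"
proof -
  let ?h = "\<lambda>z. gradient (e i) z \<bullet> gradient (e j) z"
  have meas: "interior T \<inter> \<Omega> \<in> lmeasurable" for T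
    using open_domain bounded_domain by (intro lmeasurable_open bounded_Int) auto
  have "set_integrable lebesgue (interior T \<inter> \<Omega>) ?h" if T: "T \<in> \<T>" for T
  proof -
    obtain a where a: "\<And>z. z \<in> interior T \<Longrightarrow> gradient (e i) z = a"
      using gradient_basis_constant[OF T, of i] by blast
    obtain b where b: "\<And>z. z \<in> interior T \<Longrightarrow> gradient (e j) z = b"
      using gradient_basis_constant[OF T, of j] by blast
    have "set_integrable lebesgue (interior T \<inter> \<Omega>) ?h \<longleftrightarrow>
        set_integrable lebesgue (interior T \<inter> \<Omega>) (\<lambda>_. a \<bullet> b)"
      by (intro set_integrable_cong) (simp_all add: a b)
    then show ?thesis using absolutely_integrable_on_const[OF meas] by simp
  qed
  then have "set_integrable lebesgue (\<Union>T\<in>\<T>. interior T \<inter> \<Omega>) ?h"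
    using meas by (intro set_integrable_UN finite_mesh) auto
  then show ?thesis
  proof (rule absolutely_integrable_spike_set)
    have frontiers: "negligible (\<Union>T\<in>\<T>. frontier T)"
      using finite_mesh simplex_mesh by (blast intro: negligible_convex_frontier convex_simplex)
    have covered: "\<Omega> - (\<Union>T\<in>\<T>. interior T \<inter> \<Omega>) \<subseteq> (\<Union>T\<in>\<T>. frontier T)"
    proof
      fix z assume z: "z \<in> \<Omega> - (\<Union>T\<in>\<T>. interior T \<inter> \<Omega>)"
      then have "z \<in> \<Union>\<T>" using closure_subset[of \<Omega>] by (auto simp: Union_mesh)
      then obtain T where T: "T \<in> \<T>" "z \<in> T" by blast
      then have "z \<in> frontier T" using z closure_subset[of T] by (auto simp: frontier_def)
      with T show "z \<in> (\<Union>T\<in>\<T>. frontier T)" by blast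
    qed
    show "negligible {z \<in> \<Omega> - (\<Union>T\<in>\<T>. interior T \<inter> \<Omega>). ?h z \<noteq> 0}"
      using covered by (intro negligible_subset[OF frontiers]) blast
  qed (rule negligible_subset[OF negligible_empty], blast)
qed

text \<open>Zero energy makes the function constant on each simplex; continuity and connectedness
  make these constants agree.\<close>

lemma stiffness_kernel:
  assumes "v \<bullet> (stiffness_matrix \<Omega> e *v v) = 0"
  shows "v $ i = v $ j"
proof -
  let ?h = "\<lambda>z. \<Sum>i\<in>UNIV. v $ i *\<^sub>R gradient (e i) z"
  note Gram = set_integral_Gram_form[where g = "\<lambda>i. gradient (e i)", OF set_integrable_gradients, of v]
  have zero: "(LINT z:\<Omega>|lebesgue. (norm (?h z))\<^sup>2) = 0"
    using Gram(2) assms by (simp add: inner_matrix_vector_sum stiffness_matrix_def)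
  have "fe_function v constant_on T" if T: "T \<in> \<T>" for T
  proof -
    obtain a b where ab: "\<And>i z. z \<in> T \<Longrightarrow> e i z = a i \<bullet> z + b i"
        "\<And>i z. z \<in> interior T \<Longrightarrow> gradient (e i) z = a i"
      using gradient_basis_constant[OF T] by metis
    \<comment> \<open>A single zero suffices, since the gradients are constant on the
      interior.\<close>
    obtain z where "z \<in> interior T \<inter> \<Omega>" "?h z = 0"
      using set_integral_norm_eq_0_open[OF Gram(1) zero, of "interior T \<inter> \<Omega>"]
        interior_mesh_nonempty[OF T] open_domain by auto
    then have a0: "(\<Sum>i\<in>UNIV. v $ i *\<^sub>R a i) = 0" using ab(2) by simp
    have "fe_function v z = (\<Sum>i\<in>UNIV. v $ i * b i)" if "z \<in> T" for z
    proof -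
      have "fe_function v z = (\<Sum>i\<in>UNIV. v $ i *\<^sub>R a i) \<bullet> z + (\<Sum>i\<in>UNIV. v $ i * b i)"
        using that by (simp add: fe_function_def ab(1) inner_sum_left sum.distrib distrib_left)
      with a0 show ?thesis by simp
    qed
    then show ?thesis by (auto simp: constant_on_def)
  qed
  then have "fe_function v (x i) = fe_function v (x j)"
    using connected_imp_connected_closure[OF connected_domain] fe_function_continuous finite_mesh
      node_in_closure
    by (intro connected_finite_pieces_constant[of \<T>]) (auto simp: Union_mesh)
  then show ?thesis by (simp add: fe_function_node)
qed

text \<open>For a kernel vector, identity rows give \<open>v $ i = 0\<close> and stiffness rows give
  a zero residual, so the energy vanishes in either case. The nodal values are then all equal, and
  the one at \<open>j\<close> is zero.\<close>

lemma dirichlet_matrix_inj: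
  assumes "x j \<notin> \<Omega>"
  shows "inj ((*v) (dirichlet_matrix \<Omega> x e))"
proof -
  have "v = 0" if D: "dirichlet_matrix \<Omega> x e *v v = 0" for v
  proof -
    have row: "(\<Sum>k\<in>UNIV. dirichlet_matrix \<Omega> x e $ i $ k * v $ k) = 0" for i
      using D by (simp add: matrix_vector_mult_def vec_eq_iff)
    have bdry: "v $ i = 0" if "x i \<notin> \<Omega>" for i
      using row[of i] that
      by (simp add: dirichlet_matrix_def mat_def if_distrib[of "\<lambda>q. q * _"] cong: if_cong)
    have "v $ i * (stiffness_matrix \<Omega> e *v v) $ i = 0" for i
      using row[of i] bdry[of i]
      by (cases "x i \<in> \<Omega>") (auto simp: dirichlet_matrix_def matrix_vector_mult_def)
    then have "v \<bullet> (stiffness_matrix \<Omega> e *v v) = 0" 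
      by (simp only: inner_vec_def inner_real_def) simp
    from stiffness_kernel[OF this, of _ j] bdry[OF assms] show "v = 0" by (simp add: vec_eq_iff)
  qed
  then show ?thesis
    using matrix_left_invertible_ker[of "dirichlet_matrix \<Omega> x e"]
      matrix_left_invertible_injective[of "dirichlet_matrix \<Omega> x e"] by auto
qed

text \<open>With the facet sum outermost, each facet contributes a nonnegative Gram form.\<close>

lemma boundary_mass_matrix_nonneg:
  "0 \<le> v \<bullet> (boundary_block bd (boundary_mass_matrix \<Omega> \<T> e) *v v)"
proof -
  define \<F> where "\<F> = {F. F \<subseteq> frontier \<Omega> \<and> (\<exists>T\<in>\<T>. F facet_of T)}"
  have "v \<bullet> (boundary_block bd (boundary_mass_matrix \<Omega> \<T> e) *v v) =
    (\<Sum>i\<in>UNIV. \<Sum>j\<in>UNIV. \<Sum>F\<in>\<F>.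
      v $ i * v $ j * flat_surface_integral F (\<lambda>z. e (bd i) z * e (bd j) z))"
    by (simp add: inner_matrix_vector_sum boundary_block_def boundary_mass_matrix_def
        boundary_integral_def \<F>_def sum_distrib_left)
  also have "\<dots> = (\<Sum>F\<in>\<F>. \<Sum>i\<in>UNIV. \<Sum>j\<in>UNIV.
      v $ i * v $ j * flat_surface_integral F (\<lambda>z. e (bd i) z * e (bd j) z))"
    by (subst (2) sum.swap, subst sum.swap) simp
  also have "\<dots> \<ge> 0"
  proof (rule sum_nonneg)
    fix F assume "F \<in> \<F>"
    then obtain T where F: "F \<subseteq> frontier \<Omega>" "T \<in> \<T>" "F facet_of T" by (auto simp: \<F>_def)
    then have T: "int DIM('a) simplex T" by (simp add: simplex_mesh)
    have "F face_of T" "aff_dim F < DIM('a)"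
      using F(3) T by (auto simp: facet_of_def aff_dim_simplex)
    moreover have "compact F"
      using \<open>F face_of T\<close> T by (meson convex_simplex compact_simplex face_of_imp_compact)
    moreover have "continuous_on F (e (bd i))" for i
      using F(1) by (intro continuous_on_subset[OF basis_continuous]) (auto simp: frontier_def)
    ultimately show "0 \<le> (\<Sum>i\<in>UNIV. \<Sum>j\<in>UNIV.
        v $ i * v $ j * flat_surface_integral F (\<lambda>z. e (bd i) z * e (bd j) z))"
      by (intro flat_surface_integral_Gram_nonneg)
  qed
  finally show ?thesis .
qed

section \<open>The reduced matrix\<close>

lemma reduced_matrix_symmetric:
  "transpose (reduced_matrix \<Omega> \<T> x bd e \<nu>) = reduced_matrix \<Omega> \<T> x bd e \<nu>"
proof -
  have "transpose (mass_matrix \<Omega> e) = mass_matrix \<Omega> e"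
    by (simp add: mass_matrix_def transpose_def vec_eq_iff mult.commute)
  moreover have "transpose (boundary_block bd (boundary_mass_matrix \<Omega> \<T> e)) =
      boundary_block bd (boundary_mass_matrix \<Omega> \<T> e)"
    by (simp add: boundary_block_def boundary_mass_matrix_def transpose_def vec_eq_iff mult.commute)
  moreover have "transpose (P + \<nu> *\<^sub>R Q) = transpose P + \<nu> *\<^sub>R transpose Q" for P Q :: "real^'b^'b"
    by (simp add: transpose_def vec_eq_iff)
  ultimately show ?thesis
    by (simp add: reduced_matrix_def matrix_transpose_mul matrix_mul_assoc)
qed

text \<open>Strict positivity comes from the mass term because the solution matrix is injective; the
  boundary term only adds a nonnegative amount.\<close>

lemma reduced_matrix_pos:
  fixes bd :: "'b::finite \<Rightarrow> 'n"
  assumes "inj bd" "\<And>b. x (bd b) \<notin> \<Omega>" "\<nu> \<ge> 0" "v \<noteq> 0"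
  shows "v \<bullet> (reduced_matrix \<Omega> \<T> x bd e \<nu> *v v) > 0"
proof -
  define S where "S = solution_matrix \<Omega> x bd e"
  \<comment> \<open>The index type \<open>'b\<close> is inhabited, so there is a boundary node, as
    injectivity of the Dirichlet matrix requires.\<close>
  have "dirichlet_matrix \<Omega> x e ** S = boundary_columns bd (mat 1)"
    using matrix_mult_matrix_inv_of_inj[OF dirichlet_matrix_inj[OF assms(2)]]
    by (simp add: S_def solution_matrix_def matrix_mul_assoc)
  then have DS: "dirichlet_matrix \<Omega> x e *v (S *v v) = boundary_columns bd (mat 1) *v v"
    by (simp add: matrix_vector_mul_assoc)
  \<comment> \<open>The right-hand side of \<open>DS\<close> has the entries of \<open>v\<close> at
    the boundary nodes, so it is nonzero and \<open>S *v v\<close> is too.\<close>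
  have "(boundary_columns bd (mat 1) *v v) $ bd b = v $ b" for b
    using \<open>inj bd\<close>
    by (simp add: boundary_columns_def matrix_vector_mult_def mat_def inj_eq
        if_distrib[of "\<lambda>q. q * _"] cong: if_cong)
  then have "S *v v \<noteq> 0"
    using DS \<open>v \<noteq> 0\<close> by (metis matrix_vector_mult_0_right vec_eq_iff zero_index)
  then have "(S *v v) \<bullet> (mass_matrix \<Omega> e *v (S *v v)) > 0" by (rule mass_matrix_pos)
  moreover have "v \<bullet> ((transpose S ** mass_matrix \<Omega> e ** S) *v v) =
      (S *v v) \<bullet> (mass_matrix \<Omega> e *v (S *v v))"
    by (metis dot_lmul_matrix matrix_vector_mul_assoc vector_transpose_matrix)
  then have "v \<bullet> (reduced_matrix \<Omega> \<T> x bd e \<nu> *v v) =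
      (S *v v) \<bullet> (mass_matrix \<Omega> e *v (S *v v)) +
      \<nu> * (v \<bullet> (boundary_block bd (boundary_mass_matrix \<Omega> \<T> e) *v v))"
    by (simp add: reduced_matrix_def S_def matrix_vector_mult_add_rdistrib inner_add_right
        flip: scaleR_matrix_vector_assoc)
  ultimately show ?thesis
    using boundary_mass_matrix_nonneg[of v bd] \<open>\<nu> \<ge> 0\<close> by (simp add: add_pos_nonneg)
qed

end

section \<open>Convergence of the semismooth Newton method\<close>

theorem theorem4p5:
  fixes \<Omega> :: "'a::euclidean_space set"
    and \<TT> :: "'a set set set"
    and \<T> :: "'a set set"
    and x :: "'n::finite \<Rightarrow> 'a"
    and bd :: "'b::finite \<Rightarrow> 'n"
    and e :: "'n \<Rightarrow> 'a \<Rightarrow> real"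
    and y p \<beta> :: "'a \<Rightarrow> real"
    and c \<nu> :: real
    and u :: "real^'b"
  assumes dim: "DIM('a) = 2 \<or> DIM('a) = 3"
    and domain: "lipschitz_domain \<Omega>" "polyhedral_boundary \<Omega>"
    and mesh: "regular_family \<Omega> \<TT>" "\<T> \<in> \<TT>"
    and nodes: "bij_betw x UNIV (mesh_nodes \<T>)"
    and boundary_nodes: "bij_betw bd UNIV {j. x j \<in> frontier \<Omega>}"
    and basis: "nodal_basis \<T> x e"
    and target: "square_integrable \<Omega> y" "is_L2_projection \<Omega> \<T> y p"
    and bound: "continuous_on (frontier \<Omega>) \<beta>"
    and params: "c > 0" "\<nu> \<ge> 0"
  defines "A \<equiv> reduced_matrix \<Omega> \<T> x bd e \<nu>"
    and "f \<equiv> reduced_rhs \<Omega> x bd e (\<chi> j. p (x j))"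
    and "\<beta>v \<equiv> (\<chi> b. \<beta> (x (bd b)))"
  assumes solution: "is_arg_min (quadratic_objective A f) (\<lambda>v. \<forall>b. v $ b \<le> \<beta>v $ b) u"
  shows "(\<exists>\<delta>>0. \<forall>U \<Lambda>. semismooth_newton_sequence A f \<beta>v c U \<Lambda> \<and>
              dist (U 0) u < \<delta> \<and> dist (\<Lambda> 0) (f - A *v u) < \<delta> \<longrightarrow> q_superlinear U u) \<and>
         (\<forall>U \<Lambda>. semismooth_newton_sequence A f \<beta>v c U \<Lambda> \<and> convergent U \<longrightarrow> q_superlinear U u)"
proof -
  have \<Omega>: "open \<Omega>" "connected \<Omega>" "bounded \<Omega>"
    using domain(1) by (auto simp: lipschitz_domain_def)
  have "mesh_of \<Omega> \<T>" using mesh by (simp add: regular_family_def)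
  moreover have "range x \<subseteq> mesh_nodes \<T>" using nodes by (simp add: bij_betw_def)
  ultimately interpret fe_discretization \<Omega> \<T> x e
    using \<Omega> basis by (intro fe_discretization.intro)
  have bd: "inj bd" "range bd = {j. x j \<in> frontier \<Omega>}"
    using boundary_nodes by (simp_all add: bij_betw_def)
  have boundary: "x (bd b) \<notin> \<Omega>" for b
  proof -
    have "bd b \<in> {j. x j \<in> frontier \<Omega>}" using bd(2) by blast
    then show ?thesis using \<Omega>(1) by (simp add: frontier_def interior_open)
  qed
  interpret spd_quadratic A f \<beta>v c
  proof
    show "transpose A = A" unfolding A_def by (rule reduced_matrix_symmetric)
    show "v \<noteq> 0 \<Longrightarrow> v \<bullet> (A *v v) > 0" for v
      unfolding A_def by (rule reduced_matrix_pos[OF bd(1) boundary params(2)])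
    show "c > 0" by (rule params(1))
  qed
  show ?thesis
    using newton_locally_superlinear[OF solution] newton_convergent_superlinear[OF solution]
    by blast
qed

end
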